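(* Let $k$ be a finite field with $q$ elements where $q$ is a square, let $k_0\subset k$ be the subfield with $q^{1/2}$ elements, let $c\in k^*$, and let $\mu$ be the uniform distribution on $ck_0=\{cy: y\in k_0\}$ (regarded as a distribution on $k$). Then $\|\widehat\mu\|_1=q^{1/2}$. Moreover, for all integers $m,\alpha\ge 0$, if $x_0,\ldots,x_{2m+\alpha}$ are chosen independently from $\mu$, then $(x_0,\ldots,x_{2m+\alpha})\in H_m$ with probability $q^{-(\alpha+1)/2}$. In particular (case $\alpha=0$), the square Hankel matrix $(x_{i+j})_{0\le i,j\le m}$ of order $m+1$ is singular with probability $q^{-1/2}$.
   Context: For integers $m,n$ with $0\le 2m\le n+1$, $H_m\subseteq k^{n+1}$ is the set of sequences $(x_0,\ldots,x_n)$ with $x_i\in k$ for which there exist $a_0,\ldots,a_m\in k$, not all zero, such that $\sum_{i=0}^m a_ix_{i+j}=0$ for each $j=0,1,\ldots,n-m$ (here $n=2m+\alpha$). A distribution on $k$ is a function $\mu:k\to\mathbf{R}$ with $\mu(x)\ge 0$ for all $x\in k$ and $\sum_{x\in k}\mu(x)=1$. Fix a nontrivial homomorphism $\psi_0$ from the additive group of $k$ to the unit circle in $\mathbf{C}$. The Fourier transform of $\mu$ is $\widehat\mu(a)=\sum_{x\in k}\mu(x)\psi_0(ax)$ for $a\in k$, and $\|\widehat\mu\|_1=\sum_{a\in k}|\widehat\mu(a)|$. *)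

theory Defs
  imports
    "HOL-Probability.Probability"
    "HOL-Computational_Algebra.Nth_Powers"
    "HOL-Algebra.Algebraic_Closure_Type"
    "Jordan_Normal_Form.Matrix"
begin

text \<open>
  The elements of \<open>k\<^sup>n\<^sup>+\<^sup>1\<close> are the functions on \<open>{0..n}\<close> with values in \<open>k\<close>, extended by
  \<^const>\<open>undefined\<close> outside \<open>{0..n}\<close>. The set is meant for \<open>2 * m \<le> n + 1\<close>; then \<open>m \<le> n\<close>,
  so the subtraction \<open>n - m\<close> does not truncate.
\<close>

definition hankel_set :: "nat \<Rightarrow> nat \<Rightarrow> (nat \<Rightarrow> 'k::field) set" where
  "hankel_set m n = {x \<in> {0..n} \<rightarrow>\<^sub>E UNIV.
     \<exists>a :: nat \<Rightarrow> 'k. (\<exists>i\<in>{0..m}. a i \<noteq> 0) \<and>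
       (\<forall>j\<in>{0..n - m}. (\<Sum>i=0..m. a i * x (i + j)) = 0)}"

definition hankel_matrix :: "nat \<Rightarrow> (nat \<Rightarrow> 'k) \<Rightarrow> 'k mat" where
  "hankel_matrix m x = mat (m + 1) (m + 1) (\<lambda>(i, j). x (i + j))"

definition nontrivial_additive_character :: "('k::ring_1 \<Rightarrow> complex) \<Rightarrow> bool" where
  "nontrivial_additive_character \<psi> \<longleftrightarrow>
     (\<forall>x y. \<psi> (x + y) = \<psi> x * \<psi> y) \<and> (\<forall>x. cmod (\<psi> x) = 1) \<and> (\<exists>x. \<psi> x \<noteq> 1)"

definition fourier_transform ::
  "('k::{finite,field} \<Rightarrow> complex) \<Rightarrow> 'k pmf \<Rightarrow> 'k \<Rightarrow> complex" where
  "fourier_transform \<psi> \<mu> a = (\<Sum>x\<in>UNIV. complex_of_real (pmf \<mu> x) * \<psi> (a * x))"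

definition l1_norm :: "('k::finite \<Rightarrow> complex) \<Rightarrow> real" where
  "l1_norm f = (\<Sum>a\<in>UNIV. cmod (f a))"

text \<open>
  A sequence of \<open>n + 1\<close> independent samples from \<open>\<mu>\<close>, in the encoding used by
  \<^const>\<open>hankel_set\<close>.
\<close>

definition iid_sequence :: "nat \<Rightarrow> 'k pmf \<Rightarrow> (nat \<Rightarrow> 'k) pmf" where
  "iid_sequence n \<mu> = Pi_pmf {0..n} undefined (\<lambda>_. \<mu>)"

end

theory Submission
  imports Defs "Jordan_Normal_Form.Determinant"
begin

text \<open>
  Let \<open>s = q\<^sup>1\<^sup>/\<^sup>2\<close>. The Fourier transform of \<open>\<mu>\<close> is the indicator function of the annihilator of
  \<open>c k\<^sub>0\<close>, so its \<open>L\<^sup>1\<close>-norm equals its sum, which orthogonality evaluates as \<open>q / s\<close>.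

  For the Hankel part, linear algebra over \<open>k\<^sub>0\<close> suffices, and the number \<open>T\<close> of sequences of length
  \<open>N = 2 m + \<alpha> + 1\<close> in \<open>H\<^sub>m\<close> is found by counting pairs \<open>(x, a)\<close> where the polynomial \<open>a\<close> of
  degree below \<open>d\<close> annihilates \<open>x\<close>. A fixed \<open>a \<noteq> 0\<close> imposes \<open>N - d + 1\<close> independent linear
  recurrences, so there are \<open>P\<^sub>d = s\<^sup>N + (s\<^sup>d - 1) s\<^sup>d\<^sup>-\<^sup>1\<close> pairs. On the other hand, a greatest common divisor
  argument shows that the annihilators of a fixed \<open>x\<close> are, as binary forms, the multiples of a
  single one in all degrees involved, so that passing from \<open>d = m\<close> to \<open>d = m + 1\<close> multiplies their
  number by \<open>s\<close> if \<open>x \<in> H\<^sub>m\<close>, while only \<open>0\<close> annihilates \<open>x\<close> otherwise. Hence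
  \<open>P\<^bsub>m+1\<^esub> = s P\<^sub>m - (s - 1) (s\<^sup>N - T)\<close>, which gives \<open>T = s\<^sup>2\<^sup>m\<close>.
\<close>

hide_const (open) module.smult up_ring.coeff up_ring.monom Polynomials.degree

section \<open>Subfields of a field type and polynomials over them\<close>

text \<open>Closure conditions replace the record-based notion \<open>subfield\<close>, so that
  type-class arithmetic and \<open>'k poly\<close> apply directly.\<close>

locale subfield_of_type =
  fixes F :: "'k::field set"
  assumes zero_closed: "0 \<in> F"
    and one_closed: "1 \<in> F"
    and add_closed: "x \<in> F \<Longrightarrow> y \<in> F \<Longrightarrow> x + y \<in> F"
    and uminus_closed: "x \<in> F \<Longrightarrow> - x \<in> F"
    and mult_closed: "x \<in> F \<Longrightarrow> y \<in> F \<Longrightarrow> x * y \<in> F"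
    and inverse_closed: "x \<in> F \<Longrightarrow> inverse x \<in> F"
begin

lemma diff_closed: "x \<in> F \<Longrightarrow> y \<in> F \<Longrightarrow> x - y \<in> F"
  using add_closed[of x "- y"] uminus_closed by simp

lemma divide_closed: "x \<in> F \<Longrightarrow> y \<in> F \<Longrightarrow> x / y \<in> F"
  unfolding divide_inverse by (intro mult_closed inverse_closed)

lemma sum_closed: "(\<And>i. i \<in> A \<Longrightarrow> f i \<in> F) \<Longrightarrow> sum f A \<in> F"
  by (induction A rule: infinite_finite_induct) (auto intro: zero_closed add_closed)

definition polys :: "'k poly set" where
  "polys = {p. \<forall>i. coeff p i \<in> F}"

text \<open>Vanishing coefficients instead of a bound on \<open>degree\<close> put 0 into every
  \<open>polys_below d\<close>, including \<open>d = 0\<close>; this makes each of them an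
  \<open>F\<close>-vector space of dimension \<open>d\<close>.\<close>

definition polys_below :: "nat \<Rightarrow> 'k poly set" where
  "polys_below d = {p \<in> polys. \<forall>i\<ge>d. coeff p i = 0}"

lemma coeff_in: "p \<in> polys \<Longrightarrow> coeff p i \<in> F"
  by (simp add: polys_def)

lemma polys_zero: "0 \<in> polys"
  by (simp add: polys_def zero_closed)

lemma polys_one: "1 \<in> polys"
  by (simp add: polys_def zero_closed one_closed)

lemma polys_add: "p \<in> polys \<Longrightarrow> q \<in> polys \<Longrightarrow> p + q \<in> polys"
  by (simp add: polys_def add_closed)

lemma polys_diff: "p \<in> polys \<Longrightarrow> q \<in> polys \<Longrightarrow> p - q \<in> polys"
  by (simp add: polys_def diff_closed)

lemma polys_mult: "p \<in> polys \<Longrightarrow> q \<in> polys \<Longrightarrow> p * q \<in> polys"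
  by (simp add: polys_def coeff_mult mult_closed sum_closed)

lemma polys_smult: "c \<in> F \<Longrightarrow> p \<in> polys \<Longrightarrow> smult c p \<in> polys"
  by (simp add: polys_def mult_closed)

lemma polys_pCons: "c \<in> F \<Longrightarrow> p \<in> polys \<Longrightarrow> pCons c p \<in> polys"
  by (simp add: polys_def coeff_pCons split: nat.split)

lemma polys_monom: "c \<in> F \<Longrightarrow> monom c n \<in> polys"
  by (simp add: polys_def zero_closed)

lemma polys_below_imp_polys: "p \<in> polys_below d \<Longrightarrow> p \<in> polys"
  by (simp add: polys_below_def)

lemma polys_below_degree_iff: "p \<noteq> 0 \<Longrightarrow> p \<in> polys_below d \<longleftrightarrow> p \<in> polys \<and> degree p < d"
  unfolding polys_below_def
  by (auto intro: coeff_eq_0) (metis leading_coeff_0_iff not_le)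

lemma polys_below_zero: "0 \<in> polys_below d"
  by (simp add: polys_below_def polys_zero)

lemma polys_below_mono: "p \<in> polys_below d \<Longrightarrow> d \<le> e \<Longrightarrow> p \<in> polys_below e"
  by (auto simp: polys_below_def)

lemma polys_below_diff: "p \<in> polys_below d \<Longrightarrow> q \<in> polys_below d \<Longrightarrow> p - q \<in> polys_below d"
  by (simp add: polys_below_def polys_diff)

lemma polys_below_mult:
  assumes "p \<in> polys" "q \<in> polys_below d"
  shows "p * q \<in> polys_below (degree p + d)"
proof (cases "p * q = 0")
  case False
  then show ?thesis
    using assms by (auto simp: polys_below_degree_iff degree_mult_eq polys_mult)
qed (metis polys_below_zero)

lemma polys_below_mult_cancel:
  assumes "p \<noteq> 0" "q \<in> polys" "p * q \<in> polys_below (degree p + d)"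
  shows "q \<in> polys_below d"
proof (cases "q = 0")
  case False
  with assms have "p * q \<noteq> 0" by simp
  then show ?thesis
    using assms False by (auto simp: polys_below_degree_iff degree_mult_eq)
qed (simp add: polys_below_zero)

lemma polys_below_0: "polys_below 0 = {0}"
  by (auto simp: polys_below_def polys_zero poly_eq_iff)

lemma polys_below_Suc: "polys_below (Suc d) = (\<lambda>(c, p). pCons c p) ` (F \<times> polys_below d)"
proof (intro equalityI subsetI)
  fix p assume p: "p \<in> polys_below (Suc d)"
  obtain c r where pc: "p = pCons c r" by (cases p)
  have co: "coeff p (Suc i) = coeff r i" "coeff p 0 = c" for i by (simp_all add: pc)
  have "r \<in> polys_below d" "c \<in> F"
    using p unfolding polys_below_def polys_def
    by (auto simp flip: co)
  then show "p \<in> (\<lambda>(c, p). pCons c p) ` (F \<times> polys_below d)"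
    using pc by auto
next
  fix p assume "p \<in> (\<lambda>(c, p). pCons c p) ` (F \<times> polys_below d)"
  then show "p \<in> polys_below (Suc d)"
    by (auto simp: polys_below_def polys_pCons coeff_pCons split: nat.split)
qed

lemma card_polys_below: "card (polys_below d) = card F ^ d"
proof (induction d)
  case (Suc d)
  have "inj_on (\<lambda>(c, p). pCons c p) (F \<times> polys_below d)"
    by (auto simp: inj_on_def)
  then show ?case
    by (simp add: polys_below_Suc card_image card_cartesian_product Suc.IH)
qed (simp add: polys_below_0)

text \<open>Long division divides by nothing but the leading coefficient of \<open>g\<close>, so
  quotient and remainder stay over \<open>F\<close>. Each coefficient that the induction prepends to
  \<open>f\<close> costs one division step.\<close>

lemma division_polys:
  assumes "f \<in> polys" "g \<in> polys" "g \<noteq> 0"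
  shows "\<exists>q\<in>polys. f - g * q \<in> polys_below (degree g)"
  using assms(1)
proof (induction f)
  case 0
  show ?case
    by (rule bexI[of _ 0]) (simp_all add: polys_below_zero polys_zero)
next
  case (pCons c f)
  have cF: "c \<in> F" and fF: "f \<in> polys"
    using pCons.prems by (auto simp: polys_def coeff_pCons split: nat.splits)
  then obtain q where q: "q \<in> polys" and r: "f - g * q \<in> polys_below (degree g)"
    using pCons.IH by blast
  \<comment> \<open>Prepending \<open>c\<close> shifts the old remainder up by one degree, so
    \<open>r1\<close> has degree at most \<open>degree g\<close>; subtracting
    \<open>smult b g\<close> removes the coefficient there.\<close>
  define r1 where "r1 = pCons c (f - g * q)"
  define b where "b = coeff r1 (degree g) / coeff g (degree g)"
  have r1: "r1 \<in> polys_below (Suc (degree g))"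
    unfolding polys_below_Suc r1_def using cF r by auto
  have b: "b \<in> F"
    unfolding b_def using r1 assms(2) by (auto intro!: divide_closed coeff_in polys_below_imp_polys)
  have eq: "pCons c f - g * pCons b q = r1 - smult b g"
    unfolding r1_def by (simp add: algebra_simps)
  have "r1 - smult b g \<in> polys_below (degree g)"
    unfolding polys_below_def mem_Collect_eq
  proof (intro conjI allI impI)
    show "r1 - smult b g \<in> polys"
      using r1 b assms(2) by (intro polys_diff polys_smult) (auto intro: polys_below_imp_polys)
    fix i assume "degree g \<le> i"
    then consider "i = degree g" | "Suc (degree g) \<le> i" by linarith
    then show "coeff (r1 - smult b g) i = 0"
      using r1 assms(3) by cases (auto simp: polys_below_def b_def coeff_eq_0)
  qed
  then show ?case
    using q b by (intro bexI[of _ "pCons b q"]) (simp_all only: eq polys_pCons)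
qed

section \<open>Annihilators of a sequence and their divisibility structure\<close>

text \<open>
  The functional \<open>p \<mapsto> \<Sum> x\<^sub>i p\<^sub>i\<close> on polynomials of degree below \<open>N\<close>; a vector in the kernel of the
  Hankel matrix of \<open>x\<close> with \<open>d\<close> columns is a polynomial of degree below \<open>d\<close> all of whose
  multiples of degree below \<open>N\<close> it kills.
\<close>

definition functional :: "nat \<Rightarrow> (nat \<Rightarrow> 'k) \<Rightarrow> 'k poly \<Rightarrow> 'k" where
  "functional N x p = (\<Sum>i<N. x i * coeff p i)"

definition annihilators :: "nat \<Rightarrow> (nat \<Rightarrow> 'k) \<Rightarrow> nat \<Rightarrow> 'k poly set" where
  "annihilators N x d =
     {a \<in> polys_below d. \<forall>b\<in>polys_below (Suc N - d). functional N x (a * b) = 0}"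

lemma functional_add: "functional N x (p + q) = functional N x p + functional N x q"
  by (simp add: functional_def algebra_simps sum.distrib)

lemma functional_0: "functional N x 0 = 0"
  by (simp add: functional_def)

lemma annihilators_polys_below: "a \<in> annihilators N x d \<Longrightarrow> a \<in> polys_below d"
  by (simp add: annihilators_def)

lemma annihilators_degree: "a \<in> annihilators N x d \<Longrightarrow> a \<noteq> 0 \<Longrightarrow> a \<in> polys \<and> degree a < d"
  using annihilators_polys_below polys_below_degree_iff by blast

lemma annihilators_0: "0 \<in> annihilators N x d"
  by (simp add: annihilators_def polys_below_zero functional_0)

lemma annihilators_Suc_mono: "annihilators N x d \<subseteq> annihilators N x (Suc d)"
  using polys_below_mono[of _ "Suc N - Suc d" "Suc N - d"] polys_below_mono[of _ d "Suc d"]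
  by (auto simp: annihilators_def)

text \<open>Bezout over \<open>F\<close>: a nonzero \<open>u\<close> of least degree in the ideal
  generated by \<open>f\<close> and \<open>g\<close> divides the whole ideal, because remainders
  modulo \<open>u\<close> lie in the ideal and have smaller degree.\<close>

lemma exists_combination_dividing:
  assumes f: "f \<in> polys" "f \<noteq> 0" and g: "g \<in> polys"
  obtains u f' g' A B where "u \<in> polys" "u \<noteq> 0" "f' \<in> polys" "g' \<in> polys" "A \<in> polys" "B \<in> polys"
    "f = u * f'" "g = u * g'" "u = f * A + g * B"
proof -
  define I where "I = {f * A + g * B | A B. A \<in> polys \<and> B \<in> polys}"
  have If: "f \<in> I"
    unfolding I_def mem_Collect_eq
    by (rule exI[of _ 1], rule exI[of _ 0]) (simp add: polys_one polys_zero)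
  have Ig: "g \<in> I"
    unfolding I_def mem_Collect_eq
    by (rule exI[of _ 0], rule exI[of _ 1]) (simp add: polys_one polys_zero)
  obtain u where u: "u \<in> I" "u \<noteq> 0" and least: "\<And>v. v \<in> I \<Longrightarrow> v \<noteq> 0 \<Longrightarrow> degree u \<le> degree v"
    using ex_has_least_nat[of "\<lambda>v. v \<in> I \<and> v \<noteq> 0" f degree] If f(2) by blast
  then obtain A B where AB: "A \<in> polys" "B \<in> polys" "u = f * A + g * B"
    unfolding I_def by blast
  have uF: "u \<in> polys"
    using AB f(1) g by (simp add: polys_add polys_mult)
  have "\<exists>w\<in>polys. v = u * w" if v: "v \<in> I" for v
  proof -
    obtain C D where CD: "C \<in> polys" "D \<in> polys" "v = f * C + g * D"
      using v unfolding I_def by blast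
    have vF: "v \<in> polys"
      using CD f(1) g by (simp add: polys_add polys_mult)
    obtain w where w: "w \<in> polys" "v - u * w \<in> polys_below (degree u)"
      using division_polys[OF vF uF u(2)] by blast
    have "v - u * w = f * (C - A * w) + g * (D - B * w)"
      unfolding AB(3) CD(3) by (simp add: algebra_simps)
    then have "v - u * w \<in> I"
      unfolding I_def using AB(1,2) CD(1,2) w(1) by (blast intro: polys_diff polys_mult)
    moreover have "degree (v - u * w) < degree u" if "v - u * w \<noteq> 0"
      using that w(2) by (simp add: polys_below_degree_iff)
    ultimately have "v - u * w = 0"
      using least not_le by blast
    then show ?thesis using w(1) by auto
  qed
  then obtain f' g' where "f' \<in> polys" "f = u * f'" "g' \<in> polys" "g = u * g'"
    using If Ig by meson
  then show ?thesis
    using that uF u(2) AB by blast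
qed

text \<open>
  This is the statement that the greatest common divisor of two annihilators is an annihilator,
  for binary forms: \<open>f\<close> and \<open>g\<close> stand for forms of degrees \<open>a - 1\<close> and \<open>b - 1\<close>, so that
  \<open>a - 1 - degree f\<close> is the multiplicity of the zero of the first form at infinity.
\<close>

lemma common_divisor_annihilator:
  assumes f: "f \<in> annihilators N x a" "f \<noteq> 0" and g: "g \<in> annihilators N x b" "g \<noteq> 0"
    and ab: "a \<le> N" "b \<le> N" "a + b \<le> N + 2" and infty: "a + degree g \<le> b + degree f"
  obtains u f' g' where "u \<in> annihilators N x (degree u + a - degree f)"
    "f = u * f'" "g = u * g'" "f' \<in> polys" "g' \<in> polys"
proof -
  have fF: "f \<in> polys" "degree f < a" and gF: "g \<in> polys" "degree g < b"
    using f g annihilators_degree by blast+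
  obtain u f' g' A B where u: "u \<in> polys" "u \<noteq> 0" and f': "f' \<in> polys" "f = u * f'"
    and g': "g' \<in> polys" "g = u * g'" and AB: "A \<in> polys" "B \<in> polys" "u = f * A + g * B"
    using exists_combination_dividing[OF fF(1) f(2) gF(1)] by metis
  have nz: "f' \<noteq> 0" "g' \<noteq> 0" using f g f' g' by auto
  have degf: "degree f = degree u + degree f'"
    using f' u nz by (simp add: degree_mult_eq)
  have "functional N x (u * p) = 0"
    if p: "p \<in> polys_below (Suc N - (degree u + a - degree f))" for p
  proof -
    have pF: "p \<in> polys" using p by (rule polys_below_imp_polys)
    \<comment> \<open>The Bezout identity writes \<open>u * p\<close> as
      \<open>f * (A * p) + g * (B * p)\<close>, with no control on degrees. Reducing
      \<open>B * p\<close> modulo \<open>f'\<close> controls the cofactor of \<open>g\<close>, and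
      \<open>g * f' = f * g'\<close> moves the quotient over to the cofactor of
      \<open>f\<close>.\<close>
    obtain Q where Q: "Q \<in> polys" "B * p - f' * Q \<in> polys_below (degree f')"
      using division_polys[of "B * p" f'] f' nz AB pF polys_mult by blast
    define R where "R = B * p - f' * Q"
    define A' where "A' = A * p + g' * Q"
    have A'F: "A' \<in> polys"
      unfolding A'_def using AB pF g' Q by (intro polys_add polys_mult)
    have "u * p = f * (A * p) + g * (B * p)"
      by (subst AB(3)) (simp add: algebra_simps)
    also have "g * (B * p) = g * R + g * f' * Q"
      by (simp add: R_def algebra_simps)
    also have "g * f' * Q = f * (g' * Q)"
      unfolding f'(2) g'(2) by (simp add: algebra_simps)
    finally have up: "u * p = f * A' + g * R"
      by (simp add: A'_def algebra_simps)
    have R: "R \<in> polys_below (degree f')" using Q by (simp add: R_def)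
    have "R \<in> polys_below (Suc N - b)"
      using R by (rule polys_below_mono) (use degf fF ab in linarith)
    then have gR: "functional N x (g * R) = 0"
      using g unfolding annihilators_def by blast
    have "u * p \<in> polys_below (degree u + (Suc N - (degree u + a - degree f)))"
      using polys_below_mult[OF u(1) p] .
    then have "u * p \<in> polys_below (degree f + (Suc N - a))"
      by (rule polys_below_mono) (use degf fF ab in linarith)
    moreover have "g * R \<in> polys_below (degree g + degree f')"
      using polys_below_mult[OF gF(1) R] .
    \<comment> \<open>By \<open>infty\<close>, \<open>degree f' < a\<close> and
      \<open>a + b \<le> N + 2\<close>, this product obeys the same bound as \<open>u * p\<close>.
      Hence so does the difference \<open>f * A'\<close>, and \<open>A'\<close> is an admissible
      test polynomial for \<open>f\<close>.\<close>
    then have "g * R \<in> polys_below (degree f + (Suc N - a))"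
      by (rule polys_below_mono) (use degf fF gF ab infty in linarith)
    ultimately have "u * p - g * R \<in> polys_below (degree f + (Suc N - a))"
      by (rule polys_below_diff)
    then have "A' \<in> polys_below (Suc N - a)"
      using up by (intro polys_below_mult_cancel[OF f(2) A'F]) simp
    then have "functional N x (f * A') = 0"
      using f unfolding annihilators_def by blast
    then show ?thesis using gR up functional_add by simp
  qed
  \<comment> \<open>The index is one more than the degree of the common divisor as a form:
    \<open>degree u\<close> plus the multiplicity \<open>a - 1 - degree f\<close> at infinity, the
    smaller of the two by \<open>infty\<close>.\<close>
  moreover have "u \<in> polys_below (degree u + a - degree f)"
    using u fF by (simp add: polys_below_degree_iff)
  ultimately have "u \<in> annihilators N x (degree u + a - degree f)"
    unfolding annihilators_def by blast
  then show ?thesis using that f' g' by blast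
qed

text \<open>The greatest common divisor of \<open>h\<close> and another annihilator \<open>g\<close>
  is again an annihilator. Minimality of \<open>d\<^sub>0\<close> forbids it a smaller form degree
  than that of \<open>h\<close>, so \<open>h\<close> divides \<open>g\<close> as a form.\<close>

lemma annihilators_eq_multiples:
  assumes h: "h \<in> annihilators N x d\<^sub>0" "h \<noteq> 0"
    and minimal: "\<And>e. e < d\<^sub>0 \<Longrightarrow> annihilators N x e \<subseteq> {0}"
    and d: "d\<^sub>0 \<le> d" "d \<le> N" "d\<^sub>0 + d \<le> N + 2"
  shows "annihilators N x d = (\<lambda>p. h * p) ` polys_below (Suc d - d\<^sub>0)"
proof (intro equalityI subsetI)
  have hF: "h \<in> polys" "degree h < d\<^sub>0"
    using h annihilators_degree by blast+
  fix g assume "g \<in> (\<lambda>p. h * p) ` polys_below (Suc d - d\<^sub>0)"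
  then obtain p where p: "p \<in> polys_below (Suc d - d\<^sub>0)" "g = h * p" by blast
  have pF: "p \<in> polys" using p(1) by (rule polys_below_imp_polys)
  have "functional N x (g * b) = 0" if b: "b \<in> polys_below (Suc N - d)" for b
  proof -
    have "p * b \<in> polys_below (Suc N - d\<^sub>0)"
    proof (cases "p * b = 0")
      case False
      then show ?thesis
        using p b pF d by (auto simp: polys_below_degree_iff degree_mult_eq polys_mult)
    qed (metis polys_below_zero)
    then have "functional N x (h * (p * b)) = 0"
      using h unfolding annihilators_def by blast
    then show ?thesis by (simp add: p mult.assoc)
  qed
  moreover have "g \<in> polys_below (degree h + (Suc d - d\<^sub>0))"
    unfolding p(2) using hF p by (intro polys_below_mult)
  then have "g \<in> polys_below d"
    by (rule polys_below_mono) (use hF d in linarith)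
  ultimately show "g \<in> annihilators N x d"
    unfolding annihilators_def by blast
next
  have hF: "h \<in> polys" "degree h < d\<^sub>0"
    using h annihilators_degree by blast+
  fix g assume g: "g \<in> annihilators N x d"
  show "g \<in> (\<lambda>p. h * p) ` polys_below (Suc d - d\<^sub>0)"
  proof (cases "g = 0")
    case True
    then show ?thesis
      using polys_below_zero by (intro image_eqI[of _ _ 0]) auto
  next
    case False
    have gF: "g \<in> polys" "degree g < d"
      using g False annihilators_degree by blast+
    have ge: "d\<^sub>0 \<le> e" if "u \<in> annihilators N x e" "u \<noteq> 0" for u e
      using that minimal[of e] by (meson leI singletonD subsetD)
    obtain u h' g' where u: "h = u * h'" "g = u * g'" "h' \<in> polys" "g' \<in> polys"
      and deg: "degree h \<le> degree u" "degree g + d\<^sub>0 \<le> d + degree h"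
    \<comment> \<open>The cases compare the multiplicities of \<open>h\<close> and \<open>g\<close>
      at infinity, since \<open>common_divisor_annihilator\<close> takes first the form with the
      smaller one.\<close>
    proof (cases "d\<^sub>0 + degree g \<le> d + degree h")
      case True
      obtain u h' g' where *: "u \<in> annihilators N x (degree u + d\<^sub>0 - degree h)"
        "h = u * h'" "g = u * g'" "h' \<in> polys" "g' \<in> polys"
        using common_divisor_annihilator[OF h g False _ d(2) d(3) True] d by auto
      then have "d\<^sub>0 \<le> degree u + d\<^sub>0 - degree h"
        using ge h(2) by auto
      then show ?thesis using that[OF *(2-5)] True hF by simp
    next
      case ge': False
      obtain u g' h' where *: "u \<in> annihilators N x (degree u + d - degree g)"
        "g = u * g'" "h = u * h'" "g' \<in> polys" "h' \<in> polys"
        using common_divisor_annihilator[OF g False h d(2)] d ge' by auto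
      \<comment> \<open>This case is contradictory: as \<open>g\<close> has the smaller multiplicity
        at infinity, the index of \<open>u\<close> lies below \<open>d\<^sub>0\<close>.\<close>
      then have "d\<^sub>0 \<le> degree u + d - degree g"
        using ge h(2) by auto
      moreover have "degree u \<le> degree h"
        using * h by (auto simp: degree_mult_eq)
      ultimately show ?thesis using that[OF *(3,2,5,4)] ge' gF by simp
    qed
    have "degree h' = 0" "h' \<noteq> 0"
      using u h deg by (auto simp: degree_mult_eq)
    then obtain c where c: "h' = [:c:]" "c \<noteq> 0"
      by (auto elim: degree_eq_zeroE)
    have cF: "c \<in> F" using u(3) coeff_in[of h' 0] c by simp
    define p where "p = smult (inverse c) g'"
    have pF: "p \<in> polys"
      unfolding p_def using cF u by (intro polys_smult inverse_closed)
    have gp: "g = h * p" using c by (simp add: u p_def)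
    have "h * p \<in> polys_below (degree h + (Suc d - d\<^sub>0))"
      unfolding gp[symmetric] using gF False deg d by (simp add: polys_below_degree_iff)
    then have "p \<in> polys_below (Suc d - d\<^sub>0)"
      using h pF polys_below_mult_cancel by blast
    then show ?thesis using gp by blast
  qed
qed

text \<open>Let \<open>d\<^sub>0\<close> be the first index with a nonzero annihilator. From there
  up to \<open>Suc d\<close> the multiples of \<open>h\<close> number
  \<open>card F ^ (Suc e - d\<^sub>0)\<close>, the hypothesis \<open>2 * d < N\<close> giving
  \<open>d\<^sub>0 + e \<le> N + 2\<close>. If \<open>d\<^sub>0 = Suc d\<close>, the counts are
  \<open>card F\<close> and 1.\<close>

lemma card_annihilators_Suc:
  assumes "2 * d < N" and nontrivial: "annihilators N x (Suc d) \<noteq> {0}"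
  shows "card (annihilators N x (Suc d)) = card F * card (annihilators N x d)"
proof -
  define d\<^sub>0 where "d\<^sub>0 = (LEAST e. annihilators N x e \<noteq> {0})"
  have "annihilators N x d\<^sub>0 \<noteq> {0}"
    unfolding d\<^sub>0_def using nontrivial by (rule LeastI)
  then obtain h where h: "h \<in> annihilators N x d\<^sub>0" "h \<noteq> 0"
    using annihilators_0 by blast
  have minimal: "annihilators N x e = {0}" if "e < d\<^sub>0" for e
    using not_less_Least[OF that[unfolded d\<^sub>0_def]] by simp
  have le: "d\<^sub>0 \<le> Suc d"
    unfolding d\<^sub>0_def using nontrivial by (rule Least_le)
  have inj: "inj_on (\<lambda>p. h * p) A" for A
    using h by (auto simp: inj_on_def)
  have *: "card (annihilators N x e) = card F ^ (Suc e - d\<^sub>0)" if "d\<^sub>0 \<le> e" "e \<le> Suc d" for e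
    using that assms(1) le minimal annihilators_eq_multiples[OF h, of e]
    by (simp add: card_image[OF inj] card_polys_below)
  show ?thesis
  proof (cases "d\<^sub>0 \<le> d")
    case True
    then show ?thesis using * le by (simp add: Suc_diff_le)
  next
    case False
    then have "d\<^sub>0 = Suc d" using le by simp
    then show ?thesis using *[of "Suc d"] minimal[of d] by simp
  qed
qed

section \<open>Linear recurrences and the count of annihilated sequences\<close>

lemma functional_sum: "functional N x (sum f A) = (\<Sum>i\<in>A. functional N x (f i))"
  by (induction A rule: infinite_finite_induct) (simp_all add: functional_0 functional_add)

lemma functional_smult: "functional N x (smult c p) = c * functional N x p"
  by (simp add: functional_def sum_distrib_left mult.left_commute)

lemma functional_mult_monom:
  assumes "a \<in> polys_below d" "j + d \<le> N"
  shows "functional N x (a * monom 1 j) = (\<Sum>i<d. coeff a i * x (i + j))"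
proof -
  have "functional N x (a * monom 1 j) = (\<Sum>k<N. x k * (if k < j then 0 else coeff a (k - j)))"
    by (simp add: functional_def coeff_monom_mult mult.commute[of a] cong: if_cong)
  also have "\<dots> = (\<Sum>k\<in>{j..<j + d}. coeff a (k - j) * x k)"
    using assms by (intro sum.mono_neutral_cong_right) (auto simp: polys_below_def not_less)
  also have "\<dots> = (\<Sum>i<d. coeff a i * x (i + j))"
    by (rule sum.reindex_bij_witness[of _ "\<lambda>i. i + j" "\<lambda>k. k - j"]) auto
  finally show ?thesis .
qed

text \<open>By linearity it suffices to test the multipliers \<open>monom 1 j\<close>; each of them
  shifts \<open>a\<close> and yields one equation of the Hankel system.\<close>

lemma annihilators_iff:
  assumes "d \<le> N"
  shows "a \<in> annihilators N x d \<longleftrightarrow>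
    a \<in> polys_below d \<and> (\<forall>j\<le>N - d. (\<Sum>i<d. coeff a i * x (i + j)) = 0)"
proof (intro iffI conjI allI impI)
  assume a: "a \<in> annihilators N x d"
  then show below: "a \<in> polys_below d" by (rule annihilators_polys_below)
  fix j assume j: "j \<le> N - d"
  have "monom 1 j \<in> polys_below (Suc N - d)"
    using j assms by (simp add: polys_below_def polys_monom one_closed)
  then have "functional N x (a * monom 1 j) = 0"
    using a unfolding annihilators_def by blast
  then show "(\<Sum>i<d. coeff a i * x (i + j)) = 0"
    using functional_mult_monom[OF below, of j N x] j assms by simp
next
  assume *: "a \<in> polys_below d \<and> (\<forall>j\<le>N - d. (\<Sum>i<d. coeff a i * x (i + j)) = 0)"
  have "functional N x (a * b) = 0" if b: "b \<in> polys_below (Suc N - d)" for b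
  proof -
    have "b = (\<Sum>j\<le>N - d. monom (coeff b j) j)"
      using b assms
      by (cases "b = 0") (auto simp: polys_below_degree_iff intro!: poly_as_sum_of_monoms'[symmetric])
    then have "a * b = (\<Sum>j\<le>N - d. smult (coeff b j) (a * monom 1 j))"
      by (metis (no_types, lifting) mult.right_neutral mult_smult_right smult_monom sum.cong sum_distrib_left)
    then show ?thesis
      using * assms by (simp add: functional_sum functional_smult functional_mult_monom[of a d])
  qed
  then show "a \<in> annihilators N x d"
    using * unfolding annihilators_def by blast
qed

text \<open>Equation \<open>j\<close> determines entry \<open>e + j\<close> from the earlier ones,
  so \<open>M\<close> entries are determined and the other \<open>N - M\<close> are free. The
  induction strips off the last entry.\<close>

lemma card_recurrence_solutions:
  assumes coeffs: "\<And>i. a i \<in> F" "a e \<noteq> 0" and c: "c \<noteq> 0" and "e + M \<le> N"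
  shows "card {x \<in> {..<N} \<rightarrow>\<^sub>E (*) c ` F. \<forall>j<M. (\<Sum>i\<le>e. a i * x (i + j)) = 0} = card F ^ (N - M)"
  using assms(4)
proof (induction N arbitrary: M)
  case 0
  then show ?case by simp
next
  case (Suc N)
  define G where "G = (*) c ` F"
  define S where "S N M = {x \<in> {..<N} \<rightarrow>\<^sub>E G. \<forall>j<M. (\<Sum>i\<le>e. a i * x (i + j)) = 0}" for N M
  have IH: "card (S N M) = card F ^ (N - M)" if "e + M \<le> N" for M
    using Suc.IH[OF that] by (simp add: S_def G_def)
  have cardG: "card G = card F"
    unfolding G_def using c by (intro card_image) (auto simp: inj_on_def)
  have upd: "(\<Sum>i\<le>e. a i * (g(N := y)) (i + j)) = (\<Sum>i\<le>e. a i * g (i + j))" if "e + j < N" for g y j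
    using that by (intro sum.cong) auto
  have PiE_Suc: "{..<Suc N} \<rightarrow>\<^sub>E G = (\<lambda>(y, g). g(N := y)) ` (G \<times> ({..<N} \<rightarrow>\<^sub>E G))"
    by (simp add: lessThan_Suc PiE_insert_eq)
  have "card (S (Suc N) M) = card F ^ (Suc N - M)"
  proof (cases "e + M \<le> N")
    \<comment> \<open>All indices in the equations are below \<open>e + M \<le> N\<close>, so the
      new entry at \<open>N\<close> is free.\<close>
    case True
    have "S (Suc N) M = (\<lambda>(y, g). g(N := y)) ` (G \<times> S N M)"
      using True unfolding S_def PiE_Suc by (auto simp: upd simp del: fun_upd_apply)
    moreover have "inj_on (\<lambda>(y, g). g(N := y)) (G \<times> S N M)"
    proof (rule inj_onI, clarsimp)
      fix y g y' g' assume "g \<in> S N M" "g' \<in> S N M" and eq: "g(N := y) = g'(N := y')"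
      then have ext: "g \<in> extensional {..<N}" "g' \<in> extensional {..<N}"
        by (auto simp: S_def PiE_def)
      then have "g i = g' i" for i
        using fun_cong[OF eq, of i] by (cases "i = N") (auto simp: extensional_def)
      then show "y = y' \<and> g = g'"
        using fun_cong[OF eq, of N] by auto
    qed
    ultimately show ?thesis
      using IH[OF True] cardG True by (simp add: card_image card_cartesian_product Suc_diff_le)
  next
    case False
    show ?thesis
    proof (cases M)
      case 0
      then show ?thesis by (simp add: S_def card_PiE cardG)
    next
      case (Suc M')
      then have N: "N = e + M'" using False Suc.prems by simp
      \<comment> \<open>Now the last equation, \<open>j = M'\<close>, reaches exactly entry
        \<open>N\<close>, with coefficient \<open>a e \<noteq> 0\<close>, and is solved for it. The
        solution lies in \<open>G\<close> because \<open>G\<close> is closed under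
        \<open>F\<close>-linear combinations.\<close>
      define next_term where "next_term g = - (\<Sum>i<e. a i * g (i + M')) / a e" for g
      have next_term: "(\<Sum>i\<le>e. a i * (g(N := y)) (i + M')) = 0 \<longleftrightarrow> y = next_term g" for g y
      proof -
        have "(\<Sum>i\<le>e. a i * (g(N := y)) (i + M')) = (\<Sum>i<e. a i * g (i + M')) + a e * y"
          unfolding N lessThan_Suc_atMost[symmetric] by simp
        moreover have "y = next_term g \<longleftrightarrow> y * a e = - (\<Sum>i<e. a i * g (i + M'))"
          unfolding next_term_def by (rule nonzero_eq_divide_eq) fact
        ultimately show ?thesis
          by (simp add: eq_neg_iff_add_eq_0 add.commute mult.commute del: fun_upd_apply)
      qed
      have in_G: "next_term g \<in> G" if "g \<in> {..<N} \<rightarrow>\<^sub>E G" for g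
      proof -
        have "\<forall>i<N. \<exists>y\<in>F. g i = c * y"
          using that by (auto simp: G_def PiE_def Pi_def)
        then obtain h where h: "\<And>i. i < N \<Longrightarrow> h i \<in> F \<and> g i = c * h i" by metis
        have "next_term g = c * (- (\<Sum>i<e. a i * h (i + M')) / a e)"
          unfolding next_term_def using h N by (simp add: sum_distrib_left mult.left_commute)
        moreover have "- (\<Sum>i<e. a i * h (i + M')) / a e \<in> F"
          using h N by (intro divide_closed uminus_closed sum_closed mult_closed coeffs) auto
        ultimately show ?thesis unfolding G_def by blast
      qed
      have "S (Suc N) M = (\<lambda>g. g(N := next_term g)) ` S N M'"
      proof -
        have iff: "g(N := y) \<in> S (Suc N) M \<longleftrightarrow> y = next_term g \<and> g \<in> S N M'"
          if gy: "g \<in> {..<N} \<rightarrow>\<^sub>E G" "y \<in> G" for g y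
        proof -
          have "g(N := y) \<in> {..<Suc N} \<rightarrow>\<^sub>E G"
            unfolding PiE_Suc using gy by (intro image_eqI[of _ _ "(y, g)"]) auto
          then have "g(N := y) \<in> S (Suc N) M \<longleftrightarrow>
              (\<forall>j<Suc M'. (\<Sum>i\<le>e. a i * (g(N := y)) (i + j)) = 0)"
            unfolding S_def Suc by blast
          also have "\<dots> \<longleftrightarrow> (\<forall>j<M'. (\<Sum>i\<le>e. a i * (g(N := y)) (i + j)) = 0) \<and> y = next_term g"
            unfolding next_term[symmetric] by (auto simp: less_Suc_eq simp del: fun_upd_apply)
          also have "\<dots> \<longleftrightarrow> (\<forall>j<M'. (\<Sum>i\<le>e. a i * g (i + j)) = 0) \<and> y = next_term g"
            using upd[of _ g y] by (simp only: N nat_add_left_cancel_less cong: all_cong)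
          also have "\<dots> \<longleftrightarrow> y = next_term g \<and> g \<in> S N M'"
            using gy(1) unfolding S_def by blast
          finally show ?thesis .
        qed
        show ?thesis
        proof (intro equalityI subsetI)
          fix x assume x: "x \<in> S (Suc N) M"
          then have "x \<in> {..<Suc N} \<rightarrow>\<^sub>E G"
            unfolding S_def by blast
          then obtain g y where g: "x = g(N := y)" "g \<in> {..<N} \<rightarrow>\<^sub>E G" "y \<in> G"
            unfolding PiE_Suc by (auto simp del: fun_upd_apply)
          then have "y = next_term g \<and> g \<in> S N M'"
            using x iff[of g y] by blast
          then show "x \<in> (\<lambda>g. g(N := next_term g)) ` S N M'"
            using g(1) by blast
        next
          fix x assume "x \<in> (\<lambda>g. g(N := next_term g)) ` S N M'"
          then obtain g where g: "g \<in> S N M'" "x = g(N := next_term g)" by blast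
          then have "g \<in> {..<N} \<rightarrow>\<^sub>E G" by (simp add: S_def)
          then show "x \<in> S (Suc N) M"
            unfolding g(2) using iff[of g "next_term g"] in_G[of g] g(1) by blast
        qed
      qed
      moreover have "inj_on (\<lambda>g. g(N := next_term g)) (S N M')"
      proof (rule inj_onI)
        fix g g' assume "g \<in> S N M'" "g' \<in> S N M'" and eq: "g(N := next_term g) = g'(N := next_term g')"
        then have ext: "g \<in> extensional {..<N}" "g' \<in> extensional {..<N}"
          by (auto simp: S_def PiE_def)
        then have "g i = g' i" for i
          using fun_cong[OF eq, of i] by (cases "i = N") (auto simp: extensional_def)
        then show "g = g'" by auto
      qed
      ultimately show ?thesis
        using IH[of M'] N Suc by (simp add: card_image)
    qed
  qed
  then show ?case by (simp add: S_def G_def)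
qed

text \<open>Cutting the sums at \<open>degree a\<close> gives a recurrence with nonzero leading
  coefficient. The count depends on the number \<open>N - d + 1\<close> of equations, not on the
  order, hence is the same for all \<open>a\<close>.\<close>

lemma card_annihilated_sequences:
  assumes a: "a \<in> polys_below d" "a \<noteq> 0" and c: "c \<noteq> 0" and d: "d \<le> N"
  shows "card {x \<in> {..<N} \<rightarrow>\<^sub>E (*) c ` F. a \<in> annihilators N x d} = card F ^ (d - 1)"
proof -
  have aF: "a \<in> polys" "degree a < d"
    using a by (auto simp: polys_below_degree_iff)
  have "(\<Sum>i<d. coeff a i * x (i + j)) = (\<Sum>i\<le>degree a. coeff a i * x (i + j))" for x :: "nat \<Rightarrow> 'k" and j
    using aF by (intro sum.mono_neutral_right) (auto simp: coeff_eq_0)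
  then have "{x \<in> {..<N} \<rightarrow>\<^sub>E (*) c ` F. a \<in> annihilators N x d} =
      {x \<in> {..<N} \<rightarrow>\<^sub>E (*) c ` F. \<forall>j<Suc (N - d). (\<Sum>i\<le>degree a. coeff a i * x (i + j)) = 0}"
    using a by (simp add: annihilators_iff[OF d] less_Suc_eq_le)
  also have "card \<dots> = card F ^ (N - Suc (N - d))"
    using a aF d by (intro card_recurrence_solutions coeff_in c) auto
  also have "N - Suc (N - d) = d - 1" using d by simp
  finally show ?thesis .
qed

text \<open>Double counting of pairs: \<open>a = 0\<close> contributes all sequences, every other
  \<open>a\<close> the same number. For \<open>d = 0\<close> the truncated exponent is harmless, as
  its factor is 0.\<close>

lemma sum_card_annihilators:
  assumes "finite F" "c \<noteq> 0" "d \<le> N"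
  shows "(\<Sum>x\<in>{..<N} \<rightarrow>\<^sub>E (*) c ` F. int (card (annihilators N x d))) =
    int (card F) ^ N + (int (card F) ^ d - 1) * int (card F) ^ (d - 1)"
proof -
  define V where "V = {..<N} \<rightarrow>\<^sub>E (*) c ` F"
  have "card ((*) c ` F) = card F"
    using assms(2) by (intro card_image) (auto simp: inj_on_def)
  then have V: "finite V" "card V = card F ^ N"
    unfolding V_def using assms by (auto simp: finite_PiE card_PiE)
  have "card F > 0" using assms(1) zero_closed by (auto simp: card_gt_0_iff)
  then have P: "finite (polys_below d)"
    using card_polys_below[of d] by (metis card.infinite less_numeral_extra(3) zero_less_power)
  have "(\<Sum>x\<in>V. int (card (annihilators N x d))) =
      (\<Sum>x\<in>V. \<Sum>a\<in>polys_below d. if a \<in> annihilators N x d then 1 else 0)"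
    using P by (intro sum.cong refl)
      (simp add: sum.If_cases annihilators_polys_below Collect_conj_eq Int_absorb1 subsetI)
  also have "\<dots> = (\<Sum>a\<in>polys_below d. int (card {x \<in> V. a \<in> annihilators N x d}))"
    by (subst sum.swap) (use V in \<open>simp add: sum.If_cases Int_def\<close>)
  also have "\<dots> = int (card {x \<in> V. 0 \<in> annihilators N x d}) +
      (\<Sum>a\<in>polys_below d - {0}. int (card {x \<in> V. a \<in> annihilators N x d}))"
    by (rule sum.remove[OF P polys_below_zero])
  also have "(\<Sum>a\<in>polys_below d - {0}. int (card {x \<in> V. a \<in> annihilators N x d})) =
      (\<Sum>a\<in>polys_below d - {0}. int (card F ^ (d - 1)))"
    using assms by (intro sum.cong refl) (simp add: V_def card_annihilated_sequences)
  also have "\<dots> = (int (card F) ^ d - 1) * int (card F) ^ (d - 1)"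
    using P polys_below_zero[of d] card_gt_0_iff[of "polys_below d"]
    by (auto simp: card_Diff_singleton card_polys_below of_nat_diff)
  finally show ?thesis
    using V by (simp add: V_def annihilators_0)
qed

theorem card_annihilated:
  assumes "finite F" "c \<noteq> 0" "2 * m < N"
  shows "card {x \<in> {..<N} \<rightarrow>\<^sub>E (*) c ` F. annihilators N x (Suc m) \<noteq> {0}} = card F ^ (2 * m)"
proof -
  define V where "V = {..<N} \<rightarrow>\<^sub>E (*) c ` F"
  define T where "T = {x \<in> V. annihilators N x (Suc m) \<noteq> {0}}"
  define s where "s = int (card F)"
  have "card ((*) c ` F) = card F"
    using assms(2) by (intro card_image) (auto simp: inj_on_def)
  then have V: "finite V" "int (card V) = s ^ N"
    unfolding V_def s_def using assms by (auto simp: finite_PiE card_PiE)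
  have "card {0, 1 :: 'k} \<le> card F"
    using assms(1) zero_closed one_closed by (intro card_mono) auto
  then have s: "s \<ge> 2" by (simp add: s_def)
  have T: "T \<subseteq> V" by (auto simp: T_def)
  have trivial: "annihilators N x m = {0}" if "annihilators N x (Suc m) = {0}" for x
    using annihilators_Suc_mono[of N x m] annihilators_0[of N x m] that by auto
  \<comment> \<open>Outside \<open>T\<close> both cardinalities are 1, and
    \<open>1 = s - (s - 1)\<close>.\<close>
  have "int (card (annihilators N x (Suc m))) =
      s * int (card (annihilators N x m)) - (s - 1) * (if x \<in> T then 0 else 1)" if "x \<in> V" for x
    using that card_annihilators_Suc[OF assms(3), of x] trivial[of x] by (auto simp: T_def s_def)
  then have "(\<Sum>x\<in>V. int (card (annihilators N x (Suc m)))) =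
      (\<Sum>x\<in>V. s * int (card (annihilators N x m)) - (s - 1) * (if x \<in> T then 0 else 1))"
    by (intro sum.cong refl)
  also have "\<dots> = s * (\<Sum>x\<in>V. int (card (annihilators N x m))) -
      (s - 1) * (\<Sum>x\<in>V. if x \<in> T then 0 else 1)"
    by (simp only: sum_subtractf sum_distrib_left)
  also have "(\<Sum>x\<in>V. if x \<in> T then 0 else 1) = int (card (V - T))"
    using V by (simp add: sum.If_cases Diff_eq)
  also have "\<dots> = s ^ N - int (card T)"
    using V T finite_subset[OF T] by (simp add: card_Diff_subset of_nat_diff card_mono)
  finally have eq: "s ^ N + (s ^ Suc m - 1) * s ^ m =
      s * (s ^ N + (s ^ m - 1) * s ^ (m - 1)) - (s - 1) * (s ^ N - int (card T))"
    using assms sum_card_annihilators[of c m N] sum_card_annihilators[of c "Suc m" N]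
    by (simp add: V_def s_def)
  \<comment> \<open>For \<open>m = 0\<close>, where \<open>m - 1\<close> truncates, both sides are
    0.\<close>
  have "s * ((s ^ m - 1) * s ^ (m - 1)) = (s ^ m - 1) * s ^ m"
    by (cases m) simp_all
  with eq have "(s - 1) * int (card T) = (s - 1) * (s ^ m * s ^ m)"
    by (simp add: algebra_simps)
  then have "int (card T) = s ^ m * s ^ m"
    using s by simp
  then have "int (card T) = int (card F ^ (2 * m))"
    by (simp add: s_def mult_2 power_add)
  then show ?thesis
    unfolding T_def V_def by (simp only: of_nat_eq_iff)
qed

section \<open>Descent of relations from the quadratic extension to the subfield\<close>

text \<open>Any \<open>\<theta>\<close> outside \<open>F\<close> works: division gives independence
  of 1 and \<open>\<theta>\<close>, and then counting pairs shows that they span.\<close>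

lemma quadratic_basis:
  assumes "finite (UNIV :: 'k set)" "card (UNIV :: 'k set) = card F ^ 2"
  obtains \<theta> where "\<And>u v. u \<in> F \<Longrightarrow> v \<in> F \<Longrightarrow> u + \<theta> * v = 0 \<Longrightarrow> u = 0 \<and> v = 0"
    "\<And>z. \<exists>u\<in>F. \<exists>v\<in>F. z = u + \<theta> * v"
proof -
  have fin: "finite F" using assms(1) by (rule finite_subset[rotated]) simp
  have "card {0, 1 :: 'k} \<le> card F"
    using fin zero_closed one_closed by (intro card_mono) auto
  then have "card F < card F ^ 2" by (simp add: power2_eq_square)
  then have "F \<noteq> UNIV" using assms(2) by auto
  then obtain \<theta> where \<theta>: "\<theta> \<notin> F" by blast
  have indep: "u = 0 \<and> v = 0" if uv: "u \<in> F" "v \<in> F" "u + \<theta> * v = 0" for u v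
  proof (cases "v = 0")
    case False
    have "\<theta> * v = - u"
      using uv(3) by (simp add: eq_neg_iff_add_eq_0 add.commute)
    with False have "\<theta> = - u / v"
      by (rule eq_divide_imp)
    then show ?thesis
      using \<theta> uv divide_closed uminus_closed by blast
  qed (use uv in simp)
  define f where "f = (\<lambda>(u, v). u + \<theta> * v)"
  have "inj_on f (F \<times> F)"
  proof (rule inj_onI, clarsimp)
    fix u v u' v' assume *: "u \<in> F" "v \<in> F" "u' \<in> F" "v' \<in> F" "f (u, v) = f (u', v')"
    then have "(u - u') + \<theta> * (v - v') = 0"
      by (simp add: f_def algebra_simps)
    then show "u = u' \<and> v = v'"
      using indep[of "u - u'" "v - v'"] * diff_closed by simp
  qed
  then have "card (f ` (F \<times> F)) = card (UNIV :: 'k set)"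
    by (simp add: card_image card_cartesian_product assms(2) power2_eq_square)
  then have "f ` (F \<times> F) = UNIV"
    using assms(1) card_subset_eq by blast
  then have "z \<in> f ` (F \<times> F)" for z by blast
  then have "\<exists>u\<in>F. \<exists>v\<in>F. z = u + \<theta> * v" for z
    by (fastforce simp: f_def)
  then show ?thesis using that indep by blast
qed

text \<open>
  The relations among the entries of \<open>x\<close> are a linear system over \<open>F\<close>, so both components of a
  solution over the quadratic extension with respect to an \<open>F\<close>-basis are solutions over \<open>F\<close>.
\<close>

lemma hankel_set_iff_annihilators:
  assumes "finite (UNIV :: 'k set)" "card (UNIV :: 'k set) = card F ^ 2"
    and c: "c \<noteq> 0" and x: "x \<in> {..<Suc n} \<rightarrow>\<^sub>E (*) c ` F" and mn: "m \<le> n"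
  shows "x \<in> hankel_set m n \<longleftrightarrow> annihilators (Suc n) x (Suc m) \<noteq> {0}"
proof
  have index: "{0..m} = {..<Suc m}" by auto
  assume "annihilators (Suc n) x (Suc m) \<noteq> {0}"
  then obtain a where a: "a \<in> annihilators (Suc n) x (Suc m)" "a \<noteq> 0"
    using annihilators_0 by blast
  then have "degree a < Suc m" using annihilators_degree by blast
  then have "\<exists>i\<in>{0..m}. coeff a i \<noteq> 0"
    using a(2) by (intro bexI[of _ "degree a"]) auto
  moreover have "\<forall>j\<in>{0..n - m}. (\<Sum>i=0..m. coeff a i * x (i + j)) = 0"
    using a(1) mn unfolding index by (simp add: annihilators_iff)
  moreover have "x \<in> {0..n} \<rightarrow>\<^sub>E UNIV"
    using x by (auto simp: PiE_def extensional_def)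
  ultimately show "x \<in> hankel_set m n"
    unfolding hankel_set_def by blast
next
  have index: "{0..m} = {..<Suc m}" by auto
  assume "x \<in> hankel_set m n"
  then obtain a :: "nat \<Rightarrow> 'k" where "\<exists>i\<in>{0..m}. a i \<noteq> 0"
    and sum_a: "\<forall>j\<in>{0..n - m}. (\<Sum>i=0..m. a i * x (i + j)) = 0"
    unfolding hankel_set_def by blast
  then obtain i\<^sub>0 where i\<^sub>0: "i\<^sub>0 \<le> m" "a i\<^sub>0 \<noteq> 0" by auto
  have a: "(\<Sum>i<Suc m. a i * x (i + j)) = 0" if "j \<le> n - m" for j
    using sum_a that unfolding index by simp
  obtain \<theta> where \<theta>: "\<And>u v. u \<in> F \<Longrightarrow> v \<in> F \<Longrightarrow> u + \<theta> * v = 0 \<Longrightarrow> u = 0 \<and> v = 0"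
    "\<And>z. \<exists>u\<in>F. \<exists>v\<in>F. z = u + \<theta> * v"
    using quadratic_basis[OF assms(1,2)] by metis
  have "\<forall>i. \<exists>u v. u \<in> F \<and> v \<in> F \<and> a i = u + \<theta> * v"
    using \<theta>(2) by blast
  then obtain u v where uv: "\<And>i. u i \<in> F" "\<And>i. v i \<in> F" "\<And>i. a i = u i + \<theta> * v i"
    by metis
  have "\<forall>i<Suc n. \<exists>y\<in>F. x i = c * y"
    using x by (auto simp: PiE_def Pi_def)
  then obtain y where y: "\<And>i. i \<le> n \<Longrightarrow> y i \<in> F \<and> x i = c * y i"
    by (metis less_Suc_eq_le)
  have le: "i + j \<le> n" if "i < Suc m" "j \<le> n - m" for i j
    using that mn by linarith
  have sol: "(\<Sum>i<Suc m. u i * x (i + j)) = 0 \<and> (\<Sum>i<Suc m. v i * x (i + j)) = 0"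
    if j: "j \<le> n - m" for j
  proof -
    \<comment> \<open>Dividing the entries by \<open>c\<close> brings both component sums into
      \<open>F\<close>, where independence of 1 and \<open>\<theta>\<close> separates them.\<close>
    define U V where "U = (\<Sum>i<Suc m. u i * y (i + j))" and "V = (\<Sum>i<Suc m. v i * y (i + j))"
    have UV: "(\<Sum>i<Suc m. u i * x (i + j)) = c * U" "(\<Sum>i<Suc m. v i * x (i + j)) = c * V"
      unfolding U_def V_def sum_distrib_left
      using y le[OF _ j] by (auto intro!: sum.cong simp del: sum.lessThan_Suc)
    have "(\<Sum>i<Suc m. a i * x (i + j)) =
        (\<Sum>i<Suc m. u i * x (i + j)) + \<theta> * (\<Sum>i<Suc m. v i * x (i + j))"
      unfolding uv(3) sum_distrib_left by (simp add: sum.distrib algebra_simps del: sum.lessThan_Suc)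
    then have "c * (U + \<theta> * V) = 0"
      using a[OF j] unfolding UV by (simp add: algebra_simps)
    then have "U + \<theta> * V = 0" using c by simp
    moreover have "U \<in> F" "V \<in> F"
      unfolding U_def V_def using uv y le[OF _ j] by (auto intro!: sum_closed mult_closed simp del: sum.lessThan_Suc)
    ultimately have "U = 0 \<and> V = 0" using \<theta>(1) by blast
    then show ?thesis using UV by simp
  qed
  have nontrivial: "annihilators (Suc n) x (Suc m) \<noteq> {0}"
    if w: "\<And>i. w i \<in> F" "w i\<^sub>0 \<noteq> 0" "\<And>j. j \<le> n - m \<Longrightarrow> (\<Sum>i<Suc m. w i * x (i + j)) = 0"
    for w
  proof -
    define p where "p = Abs_poly (\<lambda>i. if i \<le> m then w i else 0)"
    have p: "coeff p i = (if i \<le> m then w i else 0)" for i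
      unfolding p_def by (subst coeff_Abs_poly[of m]) auto
    have "p \<in> polys_below (Suc m)"
      by (simp add: polys_below_def polys_def p w(1) zero_closed)
    moreover have "(\<Sum>i<Suc m. coeff p i * x (i + j)) = (\<Sum>i<Suc m. w i * x (i + j))" for j
      by (intro sum.cong) (auto simp: p)
    ultimately have "p \<in> annihilators (Suc n) x (Suc m)"
      using w(3) mn by (simp add: annihilators_iff del: sum.lessThan_Suc)
    moreover have "p \<noteq> 0"
      using p[of i\<^sub>0] i\<^sub>0 w(2) by auto
    ultimately show ?thesis by blast
  qed
  have "u i\<^sub>0 \<noteq> 0 \<or> v i\<^sub>0 \<noteq> 0"
    using uv(3)[of i\<^sub>0] i\<^sub>0 by auto
  then show "annihilators (Suc n) x (Suc m) \<noteq> {0}"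
  proof
    assume "u i\<^sub>0 \<noteq> 0"
    with uv(1) show ?thesis
      by (rule nontrivial) (rule sol[THEN conjunct1])
  next
    assume "v i\<^sub>0 \<noteq> 0"
    with uv(2) show ?thesis
      by (rule nontrivial) (rule sol[THEN conjunct2])
  qed
qed

theorem card_hankel_set:
  assumes "finite (UNIV :: 'k set)" "card (UNIV :: 'k set) = card F ^ 2" "c \<noteq> 0" "2 * m \<le> n"
  shows "card (({0..n} \<rightarrow>\<^sub>E (*) c ` F) \<inter> hankel_set m n) = card F ^ (2 * m)"
proof -
  have "{0..n} = {..<Suc n}" by auto
  then have "({0..n} \<rightarrow>\<^sub>E (*) c ` F) \<inter> hankel_set m n =
      {x \<in> {..<Suc n} \<rightarrow>\<^sub>E (*) c ` F. annihilators (Suc n) x (Suc m) \<noteq> {0}}"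
    using hankel_set_iff_annihilators[OF assms(1-3), of _ n m] assms(4) by auto
  also have "finite F" using assms(1) by (rule finite_subset[rotated]) simp
  then have "card {x \<in> {..<Suc n} \<rightarrow>\<^sub>E (*) c ` F. annihilators (Suc n) x (Suc m) \<noteq> {0}} = card F ^ (2 * m)"
    using assms by (intro card_annihilated) auto
  finally show ?thesis .
qed

end

section \<open>Transfer from the ring record to the field type\<close>

lemma subfield_of_type_if_subfield:
  assumes "subfield K (ring_of_type_algebra :: 'k::field ring)"
  shows "subfield_of_type K"
proof -
  let ?R = "ring_of_type_algebra :: 'k ring"
  interpret R: field ?R by (rule field_from_type_algebra)
  have sel: "\<zero>\<^bsub>?R\<^esub> = 0" "\<one>\<^bsub>?R\<^esub> = 1" "carrier ?R = UNIV"
    "x \<oplus>\<^bsub>?R\<^esub> y = x + y" "x \<otimes>\<^bsub>?R\<^esub> y = x * y" for x y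
    by (simp_all add: ring_of_type_algebra_def)
  have sub: "subring K ?R"
    using subfieldE(1)[OF assms] .
  note subE = subringE[OF sub, unfolded sel]
  have minus: "\<ominus>\<^bsub>?R\<^esub> x = - x" for x
    using R.r_neg[of x] by (simp add: sel eq_neg_iff_add_eq_0 add.commute)
  show ?thesis
  proof
    show "- x \<in> K" if "x \<in> K" for x
      using subE(5)[OF that] by (simp add: minus)
    show "inverse x \<in> K" if "x \<in> K" for x
    proof (cases "x = 0")
      case False
      then have x: "x \<in> K - {\<zero>\<^bsub>?R\<^esub>}" using that by (simp add: sel)
      have "inverse x = inv\<^bsub>?R\<^esub> x"
        using R.subfield_m_inv(2)[OF assms x] by (simp add: sel inverse_unique)
      then show ?thesis using R.subfield_m_inv(1)[OF assms x] by simp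
    qed (use subE(2) in simp)
  qed (use subE in auto)
qed

section \<open>Character sums and the Fourier transform of the uniform distribution\<close>

text \<open>Translation by \<open>y\<close> permutes \<open>H\<close> and multiplies the sum by
  \<open>\<psi> y \<noteq> 1\<close>.\<close>

lemma sum_character_eq_0:
  fixes \<psi> :: "'a::ab_group_add \<Rightarrow> 'b::idom"
  assumes add: "\<And>x y. \<psi> (x + y) = \<psi> x * \<psi> y"
    and H: "\<And>x y. x \<in> H \<Longrightarrow> y \<in> H \<Longrightarrow> x + y \<in> H" "\<And>x y. x \<in> H \<Longrightarrow> y \<in> H \<Longrightarrow> x - y \<in> H"
    and y: "y \<in> H" "\<psi> y \<noteq> 1"
  shows "(\<Sum>x\<in>H. \<psi> x) = 0"
proof -
  have "(\<Sum>x\<in>H. \<psi> x) = (\<Sum>x\<in>H. \<psi> (y + x))"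
    by (rule sum.reindex_bij_witness[of _ "\<lambda>x. y + x" "\<lambda>x. x - y"]) (use H y in auto)
  also have "\<dots> = \<psi> y * (\<Sum>x\<in>H. \<psi> x)"
    by (simp add: add sum_distrib_left)
  finally show ?thesis using y(2) by (simp add: mult_cancel_right1)
qed

lemma fourier_transform_pmf_of_set:
  assumes "S \<noteq> {}"
  shows "fourier_transform \<psi> (pmf_of_set S) a = (\<Sum>x\<in>S. \<psi> (a * x)) / of_nat (card S)"
proof -
  have "fourier_transform \<psi> (pmf_of_set S) a = (\<Sum>x\<in>UNIV. if x \<in> S then \<psi> (a * x) / of_nat (card S) else 0)"
    unfolding fourier_transform_def using assms by (intro sum.cong) (auto simp: indicator_def)
  then show ?thesis
    by (simp add: sum.If_cases sum_divide_distrib)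
qed

lemma l1_norm_fourier_transform_uniform:
  fixes F :: "'k::{finite,field} set"
  assumes "subfield_of_type F" and c: "c \<noteq> 0" and \<psi>: "nontrivial_additive_character \<psi>"
  shows "l1_norm (fourier_transform \<psi> (pmf_of_set ((*) c ` F))) = real (CARD('k)) / real (card F)"
proof -
  interpret subfield_of_type F by fact
  have add: "\<psi> (x + y) = \<psi> x * \<psi> y" for x y
    using \<psi> by (simp add: nontrivial_additive_character_def)
  obtain z where z: "\<psi> z \<noteq> 1"
    using \<psi> by (auto simp: nontrivial_additive_character_def)
  have "cmod (\<psi> 0) = 1"
    using \<psi> by (simp add: nontrivial_additive_character_def)
  then have \<psi>0: "\<psi> 0 = 1"
    using add[of 0 0] by auto
  have inj: "inj_on ((*) c) F" using c by (auto simp: inj_on_def)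
  have "F \<noteq> {}" using zero_closed by blast
  then have s: "card F > 0" by (simp add: card_gt_0_iff)
  have ft: "fourier_transform \<psi> (pmf_of_set ((*) c ` F)) a = (\<Sum>y\<in>F. \<psi> (a * (c * y))) / of_nat (card F)" for a
    using \<open>F \<noteq> {}\<close> by (simp add: fourier_transform_pmf_of_set card_image[OF inj] sum.reindex[OF inj])
  \<comment> \<open>The map \<open>y \<mapsto> \<psi> (a * (c * y))\<close> is a character of the
    additive group \<open>F\<close>, so its average is 1 if it is trivial and 0 otherwise.\<close>
  have cases: "fourier_transform \<psi> (pmf_of_set ((*) c ` F)) a \<in> {0, 1}" for a
  proof (cases "\<forall>y\<in>F. \<psi> (a * (c * y)) = 1")
    case True
    then show ?thesis using s by (simp add: ft)
  next
    case False
    then obtain y where "y \<in> F" "\<psi> (a * (c * y)) \<noteq> 1" by blast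
    then have "(\<Sum>y\<in>F. \<psi> (a * (c * y))) = 0"
      by (intro sum_character_eq_0[where \<psi> = "\<lambda>y. \<psi> (a * (c * y))"])
        (auto simp: distrib_left add add_closed diff_closed)
    then show ?thesis by (simp add: ft)
  qed
  have "complex_of_real (l1_norm (fourier_transform \<psi> (pmf_of_set ((*) c ` F)))) =
      (\<Sum>a\<in>UNIV. fourier_transform \<psi> (pmf_of_set ((*) c ` F)) a)"
    unfolding l1_norm_def of_real_sum
  proof (intro sum.cong refl)
    fix a show "complex_of_real (cmod (fourier_transform \<psi> (pmf_of_set ((*) c ` F)) a)) =
        fourier_transform \<psi> (pmf_of_set ((*) c ` F)) a"
      using cases[of a] by auto
  qed
  also have "\<dots> = (\<Sum>y\<in>F. \<Sum>a\<in>UNIV. \<psi> (a * (c * y))) / of_nat (card F)"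
    unfolding ft sum_divide_distrib[symmetric] by (subst sum.swap) simp
  also have "(\<Sum>y\<in>F. \<Sum>a\<in>UNIV. \<psi> (a * (c * y))) = (\<Sum>y\<in>F. if y = 0 then of_nat CARD('k) else 0)"
  proof (intro sum.cong refl)
    fix y
    have "(\<Sum>a\<in>UNIV. \<psi> (a * (c * y))) = 0" if "y \<noteq> 0"
      \<comment> \<open>At \<open>a = z / (c * y)\<close> the argument of \<open>\<psi>\<close> is
        \<open>z\<close>, where \<open>\<psi>\<close> is not 1.\<close>
      by (rule sum_character_eq_0[where y = "z / (c * y)"]) (use that c z in \<open>auto simp: distrib_right add\<close>)
    then show "(\<Sum>a\<in>UNIV. \<psi> (a * (c * y))) = (if y = 0 then of_nat CARD('k) else 0)"
      by (simp add: \<psi>0)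
  qed
  also have "\<dots> = of_nat CARD('k)"
    using zero_closed by (simp add: sum.delta)
  finally have "complex_of_real (l1_norm (fourier_transform \<psi> (pmf_of_set ((*) c ` F)))) =
      complex_of_real (real (CARD('k)) / real (card F))"
    by simp
  then show ?thesis by (simp only: of_real_eq_iff)
qed

section \<open>Singular Hankel matrices\<close>

lemma invertible_mat_iff_det:
  fixes A :: "'a::field mat"
  assumes A: "A \<in> carrier_mat n n"
  shows "invertible_mat A \<longleftrightarrow> Determinant.det A \<noteq> 0"
proof
  assume "invertible_mat A"
  then obtain B where B: "A * B = 1\<^sub>m n" "B * A = 1\<^sub>m (dim_row B)"
    using A unfolding invertible_mat_def inverts_mat_def by auto
  have "dim_col B = n" "dim_row B = n"
    using arg_cong[OF B(1), of dim_col] arg_cong[OF B(2), of dim_col] A by auto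
  then have "B \<in> carrier_mat n n" by (rule carrier_matI[rotated])
  then have "Determinant.det A * Determinant.det B = 1"
    using det_mult[OF A] B(1) by (metis det_one)
  then show "Determinant.det A \<noteq> 0" by auto
next
  assume "Determinant.det A \<noteq> 0"
  from det_non_zero_imp_unit[OF A this, of "()"]
  obtain B where "B \<in> carrier_mat n n" "A * B = 1\<^sub>m n" "B * A = 1\<^sub>m n"
    unfolding Units_def ring_mat_def by auto
  then show "invertible_mat A"
    using A unfolding invertible_mat_def inverts_mat_def by auto
qed

text \<open>For \<open>n = 2 * m\<close> the index \<open>j\<close> runs up to
  \<open>n - m = m\<close>, so the relations \<open>a\<close> are exactly the nonzero kernel vectors
  of the matrix.\<close>

lemma not_invertible_hankel_matrix_iff:
  fixes x :: "nat \<Rightarrow> 'k::field"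
  assumes x: "x \<in> {0..2 * m} \<rightarrow>\<^sub>E UNIV"
  shows "\<not> invertible_mat (hankel_matrix m x) \<longleftrightarrow> x \<in> hankel_set m (2 * m)"
proof -
  let ?n = "Suc m"
  have A: "hankel_matrix m x \<in> carrier_mat ?n ?n" by (simp add: hankel_matrix_def)
  have index: "{0..m} = {0..<?n}" by auto
  have mult: "hankel_matrix m x *\<^sub>v v = 0\<^sub>v ?n \<longleftrightarrow>
      (\<forall>j\<in>{0..m}. (\<Sum>i=0..m. vec_index v i * x (i + j)) = 0)" if "v \<in> carrier_vec ?n" for v
  proof -
    have "vec_index (hankel_matrix m x *\<^sub>v v) j = (\<Sum>i=0..m. vec_index v i * x (i + j))" if "j < ?n" for j
      using that \<open>v \<in> carrier_vec ?n\<close> unfolding index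
      by (simp add: hankel_matrix_def scalar_prod_def mult.commute add.commute)
    moreover have "dim_vec (hankel_matrix m x *\<^sub>v v) = ?n" by (simp add: hankel_matrix_def)
    ultimately show ?thesis
      unfolding index by (auto simp: vec_eq_iff)
  qed
  have "\<not> invertible_mat (hankel_matrix m x) \<longleftrightarrow>
      (\<exists>v. v \<in> carrier_vec ?n \<and> v \<noteq> 0\<^sub>v ?n \<and> hankel_matrix m x *\<^sub>v v = 0\<^sub>v ?n)"
    using invertible_mat_iff_det[OF A] det_0_iff_vec_prod_zero_field[OF A] by simp
  also have "\<dots> \<longleftrightarrow> (\<exists>a :: nat \<Rightarrow> 'k. (\<exists>i\<in>{0..m}. a i \<noteq> 0) \<and>
      (\<forall>j\<in>{0..m}. (\<Sum>i=0..m. a i * x (i + j)) = 0))"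
  proof (intro iffI; elim exE conjE)
    fix v assume v: "v \<in> carrier_vec ?n" "v \<noteq> 0\<^sub>v ?n" "hankel_matrix m x *\<^sub>v v = 0\<^sub>v ?n"
    then have "\<exists>i\<in>{0..m}. vec_index v i \<noteq> 0"
      unfolding index by (auto simp: vec_eq_iff)
    then show "\<exists>a :: nat \<Rightarrow> 'k. (\<exists>i\<in>{0..m}. a i \<noteq> 0) \<and>
        (\<forall>j\<in>{0..m}. (\<Sum>i=0..m. a i * x (i + j)) = 0)"
      using mult[OF v(1)] v(3) by blast
  next
    fix a :: "nat \<Rightarrow> 'k"
    assume a: "\<exists>i\<in>{0..m}. a i \<noteq> 0" "\<forall>j\<in>{0..m}. (\<Sum>i=0..m. a i * x (i + j)) = 0"
    have "vec ?n a \<noteq> 0\<^sub>v ?n"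
      using a(1) unfolding index by (auto simp: vec_eq_iff)
    moreover have "hankel_matrix m x *\<^sub>v vec ?n a = 0\<^sub>v ?n"
      using mult[of "vec ?n a"] a(2) by simp
    ultimately show "\<exists>v. v \<in> carrier_vec ?n \<and> v \<noteq> 0\<^sub>v ?n \<and> hankel_matrix m x *\<^sub>v v = 0\<^sub>v ?n"
      by (intro exI[of _ "vec ?n a"]) simp
  qed
  also have "\<dots> \<longleftrightarrow> x \<in> hankel_set m (2 * m)"
    using x by (simp add: hankel_set_def mult_2)
  finally show ?thesis .
qed

section \<open>Probabilities as counts, and the conclusion\<close>

text \<open>A product of uniform distributions is uniform on the product set.\<close>

lemma prob_iid_sequence_pmf_of_set:
  assumes "finite S" "S \<noteq> {}"
  shows "measure_pmf.prob (iid_sequence n (pmf_of_set S)) A =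
    real (card (({0..n} \<rightarrow>\<^sub>E S) \<inter> A)) / real (card S) ^ Suc n"
proof -
  have PiE: "PiE_dflt {0..n} undefined (\<lambda>_. S) = {0..n} \<rightarrow>\<^sub>E S"
    by (auto simp: PiE_dflt_def PiE_def Pi_def extensional_def)
  have "iid_sequence n (pmf_of_set S) = pmf_of_set ({0..n} \<rightarrow>\<^sub>E S)"
    unfolding iid_sequence_def PiE[symmetric] using assms by (intro Pi_pmf_of_set) auto
  then show ?thesis
    using assms by (simp add: measure_pmf_of_set finite_PiE PiE_eq_empty_iff card_PiE)
qed

theorem mainTheorem4:
  fixes k\<^sub>0 :: "'k::{finite,field} set"
    and c :: 'k
    and \<psi>\<^sub>0 :: "'k \<Rightarrow> complex"
    and \<mu> :: "'k pmf"
    and q :: nat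
  assumes q_def: "q = CARD('k)"
    and q_square: "is_square q"
    and k\<^sub>0_subfield: "subfield k\<^sub>0 (ring_of_type_algebra :: 'k ring)"
    and k\<^sub>0_card: "real (card k\<^sub>0) = sqrt (real q)"
    and c_nonzero: "c \<noteq> 0"
    and \<mu>_uniform: "\<mu> = pmf_of_set {c * y | y. y \<in> k\<^sub>0}"
    and \<psi>\<^sub>0_char: "nontrivial_additive_character \<psi>\<^sub>0"
  shows "l1_norm (fourier_transform \<psi>\<^sub>0 \<mu>) = sqrt (real q)
    \<and> (\<forall>m \<alpha>. measure_pmf.prob (iid_sequence (2 * m + \<alpha>) \<mu>) (hankel_set m (2 * m + \<alpha>))
          = real q powr (- (real \<alpha> + 1) / 2))
    \<and> (\<forall>m. measure_pmf.prob (iid_sequence (2 * m) \<mu>) {x. \<not> invertible_mat (hankel_matrix m x)}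
          = real q powr (- 1 / 2))"
proof -
  interpret subfield_of_type k\<^sub>0
    using k\<^sub>0_subfield by (rule subfield_of_type_if_subfield)
  define s where "s = card k\<^sub>0"
  define G where "G = (*) c ` k\<^sub>0"
  have \<mu>: "\<mu> = pmf_of_set G"
    unfolding \<mu>_uniform G_def by (rule arg_cong[of _ _ pmf_of_set]) auto
  have "real q = real (s\<^sup>2)"
    using k\<^sub>0_card by (simp add: s_def)
  then have q: "q = s\<^sup>2" by (simp only: of_nat_eq_iff)
  have "k\<^sub>0 \<noteq> {}" using zero_closed by blast
  then have s: "s > 0" by (simp add: s_def card_gt_0_iff)
  have "G \<noteq> {}" using \<open>k\<^sub>0 \<noteq> {}\<close> by (simp add: G_def)
  have cardG: "card G = s"
    unfolding G_def s_def using c_nonzero by (intro card_image) (auto simp: inj_on_def)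
  have powr: "real q powr (- (real \<alpha> + 1) / 2) = 1 / real s ^ Suc \<alpha>" for \<alpha>
  proof -
    have "real q powr (- (real \<alpha> + 1) / 2) = (real s powr 2) powr (- (real \<alpha> + 1) / 2)"
      using s by (simp add: q)
    also have "\<dots> = real s powr (- real (Suc \<alpha>))"
      unfolding powr_powr by (simp add: add.commute)
    also have "\<dots> = 1 / real s ^ Suc \<alpha>"
      using s by (simp only: powr_minus powr_realpow of_nat_0_less_iff inverse_eq_divide)
    finally show ?thesis .
  qed
  have hankel: "measure_pmf.prob (iid_sequence (2 * m + \<alpha>) \<mu>) (hankel_set m (2 * m + \<alpha>)) =
      real q powr (- (real \<alpha> + 1) / 2)" for m \<alpha>
  proof -
    have "card (({0..2 * m + \<alpha>} \<rightarrow>\<^sub>E G) \<inter> hankel_set m (2 * m + \<alpha>)) = s ^ (2 * m)"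
      unfolding G_def s_def using q q_def c_nonzero by (intro card_hankel_set) (auto simp: s_def)
    then have "measure_pmf.prob (iid_sequence (2 * m + \<alpha>) \<mu>) (hankel_set m (2 * m + \<alpha>)) =
        real s ^ (2 * m) / real s ^ (2 * m + Suc \<alpha>)"
      unfolding \<mu> using \<open>G \<noteq> {}\<close> by (subst prob_iid_sequence_pmf_of_set) (simp_all add: cardG)
    also have "\<dots> = 1 / real s ^ Suc \<alpha>"
      using s unfolding power_add by simp
    finally show ?thesis using powr by simp
  qed
  have "measure_pmf.prob (iid_sequence (2 * m) \<mu>) {x. \<not> invertible_mat (hankel_matrix m x)} =
      real q powr (- 1 / 2)" for m
  proof -
    \<comment> \<open>The singularity event also contains functions that are not extensional on
      \<open>{0..2 * m}\<close>; the two events agree on the support of the distribution.\<close>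
    have "({0..2 * m} \<rightarrow>\<^sub>E G) \<inter> {x. \<not> invertible_mat (hankel_matrix m x)} =
        ({0..2 * m} \<rightarrow>\<^sub>E G) \<inter> hankel_set m (2 * m)"
      using not_invertible_hankel_matrix_iff[of _ m] PiE_mono[of "{0..2 * m}" "\<lambda>_. G" "\<lambda>_. UNIV"] by blast
    then show ?thesis
      using hankel[of m 0] \<open>G \<noteq> {}\<close> by (simp add: \<mu> prob_iid_sequence_pmf_of_set)
  qed
  moreover have "l1_norm (fourier_transform \<psi>\<^sub>0 \<mu>) = sqrt (real q)"
    using l1_norm_fourier_transform_uniform[OF subfield_of_type_axioms c_nonzero \<psi>\<^sub>0_char] s
    by (simp add: \<mu> G_def q flip: q_def s_def) (simp add: power2_eq_square)
  ultimately show ?thesis using hankel by blast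
qed

end
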